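(* Consider the one-parameter family $E: y^2=x^3-t^2x+t^4$ with parameter $t$. Then for every prime $p>3$ the (unnormalized) second moment of the family at $p$ is $$\sum_{t \bmod p} a_t(p)^2=p^2-p-p\left(\frac{-3}{p}\right)-p\left(\frac{12}{p}\right)-\sum_{x \bmod p}\ \sum_{y \bmod p}\left(\frac{x^3-x}{p}\right)\left(\frac{y^3-y}{p}\right).$$
   Context: For an odd prime $p$, $\left(\frac{\cdot}{p}\right)$ denotes the Legendre symbol, with $\left(\frac{u}{p}\right)=0$ if $p\mid u$. For a family $y^2=f_t(x)$ with $f_t(x)$ a cubic polynomial in $x$ with integer coefficients depending polynomially on $t$, one sets $a_t(p):=p-\#\{(x,y)\in(\mathbb{Z}/p\mathbb{Z})^2: y^2\equiv f_t(x) \bmod p\}=-\sum_{x \bmod p}\left(\frac{f_t(x)}{p}\right)$. No condition is imposed on the specialization $t$: all residues $t \bmod p$ are included, also those for which the curve is singular. *)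

theory Defs
  imports "HOL-Number_Theory.Number_Theory" "HOL-Computational_Algebra.Polynomial"
begin

text \<open>
  A one-parameter family \<open>y\<^sup>2 = f\<^sub>t(x)\<close> is given by the map \<open>t \<mapsto> f\<^sub>t\<close> into the integer polynomials
  in \<open>x\<close>. Residue classes modulo \<open>p\<close> are represented by the integers in \<open>{0..<p}\<close>. Only affine
  points are counted, and parameters with a singular fibre are not excluded.
\<close>

definition frob_trace :: "(int \<Rightarrow> int poly) \<Rightarrow> int \<Rightarrow> int \<Rightarrow> int" where
  "frob_trace f p t =
     p - int (card {(x, y). x \<in> {0..<p} \<and> y \<in> {0..<p} \<and> [y\<^sup>2 = poly (f t) x] (mod p)})"

definition second_moment :: "(int \<Rightarrow> int poly) \<Rightarrow> int \<Rightarrow> int" where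
  "second_moment f p = (\<Sum>t\<in>{0..<p}. (frob_trace f p t)\<^sup>2)"

text \<open>
  The family \<open>y\<^sup>2 = x\<^sup>3 - t\<^sup>2 x + t\<^sup>4\<close>; the coefficient list starts with the constant term.
\<close>

definition E_family :: "int \<Rightarrow> int poly" where
  "E_family t = [:t ^ 4, - (t\<^sup>2), 0, 1:]"

end

theory Submission
  imports Defs
begin

text \<open>
  Write \<open>\<chi>\<close> for the Legendre symbol. Since \<open>a\<^sub>0(p) = 0\<close>, only \<open>t \<noteq> 0\<close> matters, and there the
  substitution \<open>x \<mapsto> t x\<close> turns \<open>x\<^sup>3 - t\<^sup>2 x + t\<^sup>4\<close> into \<open>t\<^sup>3 (x\<^sup>3 - x + t)\<close>; the factor \<open>\<chi>(t\<^sup>3)\<close>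
  disappears on squaring. As \<open>\<Sum>\<^sub>t \<chi>(t + a) \<chi>(t + b)\<close> is \<open>p - 1\<close> or \<open>-1\<close> according to whether
  \<open>a \<equiv> b\<close>, the moment equals \<open>p N - p\<^sup>2 - (\<Sum>\<^sub>x \<chi>(x\<^sup>3 - x))\<^sup>2\<close> with \<open>N\<close> the number of solutions of
  \<open>x\<^sup>3 - x \<equiv> y\<^sup>3 - y\<close>. These solutions form the union of the diagonal, with \<open>p\<close> points, and the
  conic \<open>x\<^sup>2 + x y + y\<^sup>2 = 1\<close>, with \<open>p - \<chi>(-3)\<close> points, which meet in \<open>1 + \<chi>(12)\<close> points.
\<close>

section \<open>Legendre symbol and reindexing of sums over residues\<close>

lemma Legendre_cong: "[a = b] (mod p) \<Longrightarrow> Legendre a p = Legendre b p"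
  by (simp add: Legendre_def QuadRes_def cong_def)

lemma Legendre_mod [simp]: "Legendre (a mod p) p = Legendre a p"
  by (rule Legendre_cong) simp

text \<open>Solution counts are handled as sums of indicators, since these can be swapped and
  reindexed. The \<open>of_bool\<close> simp rules are switched off afterwards so that
  \<open>simp\<close> leaves such sums intact.\<close>

lemma sum_of_bool_eq_card:
  "finite A \<Longrightarrow> (\<Sum>x\<in>A. of_bool (P x) :: int) = int (card {x \<in> A. P x})"
  by (simp add: Int_def)

declare sum_of_bool_eq [simp del] sum_of_bool_mult_eq [simp del]

locale odd_prime =
  fixes p :: int
  assumes prime: "prime p" and gt_2: "p > 2"
begin

abbreviation \<chi> :: "int \<Rightarrow> int" where
  "\<chi> a \<equiv> Legendre a p"

lemma cong_mult_cancel: "\<not> p dvd c \<Longrightarrow> [c * a = c * b] (mod p) \<longleftrightarrow> [a = b] (mod p)"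
  using prime by (metis cong_mult_lcancel coprime_commute prime_imp_coprime)

text \<open>Euler's criterion gives the identity modulo \<open>p\<close>. Both sides lie in {-1, 0,
  1}, so they differ by at most 2 < \<open>p\<close> and must agree.\<close>

lemma Legendre_mult: "\<chi> (a * b) = \<chi> a * \<chi> b"
proof -
  have euler: "[\<chi> x = x ^ ((nat p - 1) div 2)] (mod p)" for x
    using euler_criterion[of "nat p" x] prime gt_2
    by simp
  have "[\<chi> (a * b) = \<chi> a * \<chi> b] (mod p)"
    using euler[of "a * b"] cong_mult[OF euler[of a] euler[of b]]
    unfolding power_mult_distrib by (rule cong_trans[OF _ cong_sym])
  then have "p dvd \<chi> (a * b) - \<chi> a * \<chi> b"
    by (simp add: cong_iff_dvd_diff)
  moreover have "\<bar>\<chi> (a * b) - \<chi> a * \<chi> b\<bar> < p"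
    using gt_2 by (simp add: Legendre_def)
  ultimately show ?thesis
    using zdvd_imp_le[of p "\<bar>\<chi> (a * b) - \<chi> a * \<chi> b\<bar>"] by fastforce
qed

lemma Legendre_power2: "(\<chi> a)\<^sup>2 = of_bool (\<not> p dvd a)"
  by (simp add: Legendre_def cong_0_iff)

text \<open>The affine map permutes the residues because \<open>c\<close> is invertible; the first
  assumption says that \<open>g\<close> is a function on residue classes.\<close>

lemma sum_affine:
  assumes g: "\<And>x. g (x mod p) = g x" and c: "\<not> p dvd c"
  shows "(\<Sum>x\<in>{0..<p}. g (c * x + d)) = (\<Sum>x\<in>{0..<p}. g x)"
proof -
  let ?h = "\<lambda>x. (c * x + d) mod p"
  have "inj_on ?h {0..<p}"
  proof (rule inj_onI)
    fix x y assume xy: "x \<in> {0..<p}" "y \<in> {0..<p}" and "?h x = ?h y"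
    then have "[c * x = c * y] (mod p)"
      by (metis cong_add_rcancel cong_def)
    then have "[x = y] (mod p)"
      by (simp only: cong_mult_cancel[OF c])
    with xy show "x = y"
      by (simp add: cong_def)
  qed
  moreover have "?h ` {0..<p} \<subseteq> {0..<p}"
    using gt_2 by auto
  ultimately have "bij_betw ?h {0..<p} {0..<p}"
    by (simp add: bij_betw_def endo_inj_surj)
  from sum.reindex_bij_betw[OF this, of g] show ?thesis
    by (simp add: g)
qed

lemma square_cong_iff: "[x\<^sup>2 = y\<^sup>2] (mod p) \<longleftrightarrow> [x = y] (mod p) \<or> [x = - y] (mod p)"
proof -
  have "x\<^sup>2 - y\<^sup>2 = (x - y) * (x - - y)"
    by (simp add: power2_eq_square algebra_simps)
  then show ?thesis
    using prime by (simp only: cong_iff_dvd_diff prime_dvd_mult_iff)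
qed

text \<open>This turns counting into character sums. For a nonzero residue the two roots
  \<open>z\<close> and \<open>-z\<close> are distinct because \<open>p\<close> is odd.\<close>

lemma sum_square_roots: "(\<Sum>y\<in>{0..<p}. of_bool [y\<^sup>2 = a] (mod p)) = 1 + \<chi> a"
proof -
  consider (zero) "[a = 0] (mod p)" | (residue) "\<not> [a = 0] (mod p)" "QuadRes p a"
    | (nonresidue) "\<not> [a = 0] (mod p)" "\<not> QuadRes p a"
    by blast
  then have "int (card {y \<in> {0..<p}. [y\<^sup>2 = a] (mod p)}) = 1 + \<chi> a"
  proof cases
    case zero
    have iff: "[y\<^sup>2 = a] (mod p) \<longleftrightarrow> p dvd y" for y
      using zero prime_dvd_power_iff[OF prime, of 2 y] by (simp add: cong_def mod_eq_0_iff_dvd)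
    have roots: "{y \<in> {0..<p}. [y\<^sup>2 = a] (mod p)} = {0}"
      unfolding iff using gt_2 by (auto simp: order_le_less zdvd_not_zless)
    show ?thesis
      unfolding roots using zero by (simp add: Legendre_def)
  next
    case residue
    then obtain z where z: "[z\<^sup>2 = a] (mod p)"
      by (auto simp: QuadRes_def)
    have iff: "[y\<^sup>2 = a] (mod p) \<longleftrightarrow> [y = z] (mod p) \<or> [y = - z] (mod p)" for y
      using z square_cong_iff[of y z] by (simp add: cong_def)
    have "{y \<in> {0..<p}. [y\<^sup>2 = a] (mod p)} = {z mod p, - z mod p}"
      unfolding iff using gt_2 by (auto simp: cong_def)
    moreover have "z mod p \<noteq> - z mod p"
    proof
      assume "z mod p = - z mod p"
      then have "p dvd z - - z"
        by (simp only: mod_eq_dvd_iff)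
      then have "p dvd 2 * z"
        by (simp only: mult_2 diff_minus_eq_add)
      then have "p dvd z"
        using prime gt_2 by (auto simp: prime_dvd_mult_iff dest: zdvd_imp_le)
      then have "[z\<^sup>2 = 0] (mod p)"
        by (simp add: cong_0_iff power2_eq_square)
      with z residue show False
        by (simp add: cong_def)
    qed
    ultimately show ?thesis
      using residue by (simp add: Legendre_def)
  next
    case nonresidue
    then have roots: "{y \<in> {0..<p}. [y\<^sup>2 = a] (mod p)} = {}"
      by (auto simp: QuadRes_def)
    show ?thesis
      unfolding roots using nonresidue by (simp add: Legendre_def)
  qed
  then show ?thesis
    by (simp add: sum_of_bool_eq_card)
qed

lemma sum_of_bool_cong:
  assumes "\<And>x. g (x mod p) = g x"
  shows "(\<Sum>x\<in>{0..<p}. of_bool [a = x] (mod p) * g x :: int) = g a"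
proof -
  have "(\<Sum>x\<in>{0..<p}. of_bool [a = x] (mod p) * g x) = (\<Sum>x\<in>{0..<p}. if x = a mod p then g x else 0)"
    by (intro sum.cong) (auto simp: cong_def)
  also have "\<dots> = g a"
    using gt_2 assms by simp
  finally show ?thesis .
qed

text \<open>Group the \<open>y\<close> by the value \<open>u\<close> of their square; each fibre has
  \<open>1 + \<chi> u\<close> elements.\<close>

lemma sum_squares:
  assumes "\<And>x. g (x mod p) = g x"
  shows "(\<Sum>y\<in>{0..<p}. g (y\<^sup>2)) = (\<Sum>u\<in>{0..<p}. (1 + \<chi> u) * g u)"
proof -
  have "(\<Sum>y\<in>{0..<p}. g (y\<^sup>2)) = (\<Sum>y\<in>{0..<p}. \<Sum>u\<in>{0..<p}. of_bool [y\<^sup>2 = u] (mod p) * g u)"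
    by (simp only: sum_of_bool_cong[where g = g, OF assms])
  also have "\<dots> = (\<Sum>u\<in>{0..<p}. (\<Sum>y\<in>{0..<p}. of_bool [y\<^sup>2 = u] (mod p)) * g u)"
    by (subst sum.swap) (simp only: sum_distrib_right)
  finally show ?thesis
    by (simp only: sum_square_roots)
qed

section \<open>Complete sums of Legendre symbols\<close>

lemma sum_Legendre: "(\<Sum>x\<in>{0..<p}. \<chi> x) = 0"
  using sum_squares[of "\<lambda>_. 1"] by (simp add: sum.distrib)

lemma sum_Legendre_affine: "\<not> p dvd c \<Longrightarrow> (\<Sum>x\<in>{0..<p}. \<chi> (c * x + d)) = 0"
  using sum_affine[of \<chi>] sum_Legendre by simp

lemma sum_of_bool_dvd: "(\<Sum>t\<in>{0..<p}. of_bool (p dvd t) * g t :: int) = g 0"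
proof -
  have "(\<Sum>t\<in>{0..<p}. of_bool (p dvd t) * g t) = (\<Sum>t\<in>{0..<p}. if t = 0 then g t else 0)"
    by (intro sum.cong) (auto simp: order_le_less zdvd_not_zless)
  then show ?thesis
    using gt_2 by simp
qed

lemma sum_Legendre_mult_shift:
  "(\<Sum>t\<in>{0..<p}. \<chi> t * \<chi> (t + b)) = p * of_bool (p dvd b) - 1"
proof -
  define S where "S b = (\<Sum>t\<in>{0..<p}. \<chi> t * \<chi> (t + b))" for b
  have S_dvd: "S b = p - 1" if "p dvd b" for b
  proof -
    have "\<chi> (t + b) = \<chi> t" for t
      using that by (intro Legendre_cong) (simp add: cong_iff_dvd_diff)
    then have "S b = (\<Sum>t\<in>{0..<p}. 1 - of_bool (p dvd t) * 1)"
      unfolding S_def by (intro sum.cong) (auto simp: Legendre_power2 simp flip: power2_eq_square)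
    also have "\<dots> = p - 1"
      using gt_2 sum_of_bool_dvd[of "\<lambda>_. 1"] by (simp only: sum_subtractf) simp
    finally show ?thesis .
  qed
  have S_not_dvd: "S b = S 1" if "\<not> p dvd b" for b
  proof -
    have per: "\<chi> (x mod p) * \<chi> (x mod p + b) = \<chi> x * \<chi> (x + b)" for x
      by (metis Legendre_mod mod_add_left_eq)
    \<comment> \<open>Scaling the variable by \<open>b\<close> only brings out
      \<open>(\<chi> b)\<^sup>2 = 1\<close>.\<close>
    have "\<chi> (b * x) * \<chi> (b * x + b) = (\<chi> b)\<^sup>2 * (\<chi> x * \<chi> (x + 1))" for x
      using Legendre_mult[of b x] Legendre_mult[of b "x + 1"]
      by (simp add: algebra_simps power2_eq_square)
    then have "\<chi> (b * x) * \<chi> (b * x + b) = \<chi> x * \<chi> (x + 1)" for x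
      using that by (simp add: Legendre_power2)
    then show ?thesis
      using sum_affine[where g = "\<lambda>x. \<chi> x * \<chi> (x + b)", OF per that, of 0]
      by (simp add: S_def)
  qed
  \<comment> \<open>Averaging over \<open>b\<close> determines the common value of \<open>S b\<close> for \<open>b\<close> prime to \<open>p\<close>.\<close>
  have "0 = (\<Sum>t\<in>{0..<p}. \<chi> t * (\<Sum>b\<in>{0..<p}. \<chi> (1 * b + t)))"
    using prime by (subst sum_Legendre_affine) auto
  also have "\<dots> = (\<Sum>b\<in>{0..<p}. S b)"
    unfolding S_def by (subst sum.swap) (simp add: sum_distrib_left add.commute)
  also have "\<dots> = (\<Sum>b\<in>{0..<p}. S 1 + of_bool (p dvd b) * (p - 1 - S 1))"
    by (intro sum.cong) (auto simp: S_dvd S_not_dvd)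
  also have "\<dots> = p * S 1 + (p - 1 - S 1)"
    using gt_2 sum_of_bool_dvd[of "\<lambda>_. p - 1 - S 1"] by (simp only: sum.distrib) simp
  also have "\<dots> = (p - 1) * (S 1 + 1)"
    by (simp add: algebra_simps)
  finally have "S 1 = - 1"
    using gt_2 by simp
  then show ?thesis
    using S_dvd[of b] S_not_dvd[of b] by (auto simp: S_def)
qed

lemma sum_Legendre_shift_mult_shift:
  "(\<Sum>t\<in>{0..<p}. \<chi> (a + t) * \<chi> (b + t)) = p * of_bool [a = b] (mod p) - 1"
proof -
  have per: "\<chi> (x mod p) * \<chi> (x mod p + (b - a)) = \<chi> x * \<chi> (x + (b - a))" for x
    by (metis Legendre_mod mod_add_left_eq)
  have "(\<Sum>t\<in>{0..<p}. \<chi> (a + t) * \<chi> (b + t)) = (\<Sum>t\<in>{0..<p}. \<chi> t * \<chi> (t + (b - a)))"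
    using sum_affine[where g = "\<lambda>x. \<chi> x * \<chi> (x + (b - a))", OF per, of 1 a] gt_2 by (simp add: algebra_simps)
  then show ?thesis
    by (simp add: sum_Legendre_mult_shift cong_iff_dvd_diff dvd_diff_commute)
qed

text \<open>Replacing \<open>y\<^sup>2\<close> by \<open>u\<close> costs the weight
  \<open>1 + \<chi> u\<close>. The part with weight 1 is a linear sum and vanishes; in the other
  part \<open>\<chi> u = \<chi> a * \<chi> (a * u)\<close> leads back to a shifted product.\<close>

lemma sum_Legendre_quadratic:
  assumes "\<not> p dvd a" "\<not> p dvd b"
  shows "(\<Sum>y\<in>{0..<p}. \<chi> (a * y\<^sup>2 + b)) = - \<chi> a"
proof -
  have per: "\<chi> (a * (u mod p) + b) = \<chi> (a * u + b)" for u
    by (intro Legendre_cong cong_add cong_mult cong_refl) simp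
  have per': "\<chi> (x mod p) * \<chi> (x mod p + b) = \<chi> x * \<chi> (x + b)" for x
    by (metis Legendre_mod mod_add_left_eq)
  have "\<chi> u = \<chi> a * \<chi> (a * u)" for u
    using assms(1) Legendre_power2[of a] by (simp add: Legendre_mult power2_eq_square flip: mult.assoc)
  then have *: "\<chi> u * \<chi> (a * u + b) = \<chi> a * (\<chi> (a * u) * \<chi> (a * u + b))" for u
    by (metis mult.assoc)
  have "(\<Sum>y\<in>{0..<p}. \<chi> (a * y\<^sup>2 + b)) = (\<Sum>u\<in>{0..<p}. (1 + \<chi> u) * \<chi> (a * u + b))"
    by (rule sum_squares) (rule per)
  also have "\<dots> = (\<Sum>u\<in>{0..<p}. \<chi> u * \<chi> (a * u + b))"
    using sum_Legendre_affine[OF assms(1)] by (simp add: distrib_right sum.distrib)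
  also have "\<dots> = \<chi> a * (\<Sum>u\<in>{0..<p}. \<chi> (a * u) * \<chi> (a * u + b))"
    unfolding sum_distrib_left by (intro sum.cong refl *)
  also have "(\<Sum>u\<in>{0..<p}. \<chi> (a * u) * \<chi> (a * u + b)) = - 1"
    using sum_affine[where g = "\<lambda>x. \<chi> x * \<chi> (x + b)", OF per' assms(1), of 0] assms(2) by (simp add: sum_Legendre_mult_shift)
  finally show ?thesis by simp
qed

section \<open>Fibre traces as character sums\<close>

lemma frob_trace_eq: "frob_trace f p t = - (\<Sum>x\<in>{0..<p}. \<chi> (poly (f t) x))"
proof -
  have "{(x, y). x \<in> {0..<p} \<and> y \<in> {0..<p} \<and> [y\<^sup>2 = poly (f t) x] (mod p)} =
      (SIGMA x:{0..<p}. {y \<in> {0..<p}. [y\<^sup>2 = poly (f t) x] (mod p)})"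
    by auto
  then have "int (card {(x, y). x \<in> {0..<p} \<and> y \<in> {0..<p} \<and> [y\<^sup>2 = poly (f t) x] (mod p)}) =
      (\<Sum>x\<in>{0..<p}. 1 + \<chi> (poly (f t) x))"
    by (simp del: atLeastLessThan_iff add: sum_of_bool_eq_card flip: sum_square_roots)
  then show ?thesis
    using gt_2 by (simp add: frob_trace_def sum.distrib)
qed

lemma frob_trace_E_family_power2:
  "(frob_trace E_family p t)\<^sup>2 = of_bool (\<not> p dvd t) * (\<Sum>x\<in>{0..<p}. \<chi> (x ^ 3 - x + t))\<^sup>2"
proof (cases "p dvd t")
  case True
  have "\<chi> (poly (E_family t) x) = \<chi> x" for x
  proof -
    \<comment> \<open>The fibre degenerates to the cusp \<open>y\<^sup>2 = x\<^sup>3\<close>, and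
      the square factor does not change the symbol, even at \<open>x = 0\<close>.\<close>
    have "[poly (E_family t) x = x\<^sup>2 * x] (mod p)"
      using True
      by (simp add: E_family_def cong_iff_dvd_diff algebra_simps power2_eq_square power4_eq_xxxx dvd_diff)
    then have "\<chi> (poly (E_family t) x) = (\<chi> x)\<^sup>2 * \<chi> x"
      by (metis Legendre_cong Legendre_mult power2_eq_square)
    then show ?thesis
      by (simp add: Legendre_power2 Legendre_def cong_0_iff)
  qed
  with True show ?thesis
    by (simp add: frob_trace_eq sum_Legendre)
next
  case False
  have per: "\<chi> (poly (E_family t) (x mod p)) = \<chi> (poly (E_family t) x)" for x
    unfolding E_family_def poly_pCons
    by (intro Legendre_cong cong_add cong_mult cong_refl) simp_all
  have "poly (E_family t) (t * x) = t\<^sup>2 * t * (x ^ 3 - x + t)" for x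
    by (simp add: E_family_def algebra_simps power2_eq_square power3_eq_cube power4_eq_xxxx)
  then have "(\<Sum>x\<in>{0..<p}. \<chi> (poly (E_family t) x)) = \<chi> (t\<^sup>2 * t) * (\<Sum>x\<in>{0..<p}. \<chi> (x ^ 3 - x + t))"
    using sum_affine[where g = "\<lambda>x. \<chi> (poly (E_family t) x)", OF per False, of 0]
    by (simp add: sum_distrib_left Legendre_mult)
  moreover have "(\<chi> (t\<^sup>2 * t))\<^sup>2 = 1"
    using False prime by (simp add: Legendre_power2 prime_dvd_mult_iff prime_dvd_power_iff)
  ultimately show ?thesis
    using False by (simp add: frob_trace_eq power_mult_distrib)
qed

section \<open>Points on the diagonal and the conic\<close>

lemma sum_diagonal: "(\<Sum>x\<in>{0..<p}. \<Sum>y\<in>{0..<p}. of_bool [x = y] (mod p) * g x) = (\<Sum>x\<in>{0..<p}. g x :: int)"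
  using sum_of_bool_cong[of "\<lambda>_. 1"] by (simp flip: sum_distrib_right)

text \<open>For fixed \<open>y\<close>, completing the square in \<open>x\<close> leaves
  \<open>1 + \<chi> (4 - 3 * y\<^sup>2)\<close> solutions, and the sum over \<open>y\<close> is a
  quadratic character sum. Since \<open>p > 3\<close>, the numbers 2, 3 and 4 are
  invertible.\<close>

lemma sum_conic:
  assumes "p > 3"
  shows "(\<Sum>y\<in>{0..<p}. \<Sum>x\<in>{0..<p}. of_bool [x\<^sup>2 + x * y + y\<^sup>2 = 1] (mod p)) = p - \<chi> (- 3)"
proof -
  have ndvd: "\<not> p dvd 2" "\<not> p dvd 4" "\<not> p dvd - 3"
    using assms prime prime_dvd_power_iff[of p 2 2] by (auto dest: zdvd_imp_le)
  have "(\<Sum>x\<in>{0..<p}. of_bool [x\<^sup>2 + x * y + y\<^sup>2 = 1] (mod p)) = 1 + \<chi> (- 3 * y\<^sup>2 + 4)" for y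
  proof -
    have per: "of_bool [(z mod p)\<^sup>2 = - 3 * y\<^sup>2 + 4] (mod p) = (of_bool [z\<^sup>2 = - 3 * y\<^sup>2 + 4] (mod p) :: int)" for z
      by (simp add: cong_def mod_simps)
    have "[x\<^sup>2 + x * y + y\<^sup>2 = 1] (mod p) \<longleftrightarrow> [(2 * x + y)\<^sup>2 = - 3 * y\<^sup>2 + 4] (mod p)" for x
    proof -
      have "(2 * x + y)\<^sup>2 - (- 3 * y\<^sup>2 + 4) = 4 * (x\<^sup>2 + x * y + y\<^sup>2 - 1)"
        by (simp add: power2_eq_square algebra_simps)
      then show ?thesis
        using prime ndvd by (simp only: cong_iff_dvd_diff prime_dvd_mult_iff) simp
    qed
    then show ?thesis
      using sum_affine[where g = "\<lambda>z. of_bool [z\<^sup>2 = - 3 * y\<^sup>2 + 4] (mod p)", OF per ndvd(1), of y]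
      by (simp only: sum_square_roots)
  qed
  then show ?thesis
    using assms by (simp only: sum.distrib sum_Legendre_quadratic[OF ndvd(3,2)]) simp
qed

text \<open>On the diagonal the conic becomes \<open>3 * x\<^sup>2 = 1\<close>. Multiplying by 12
  makes the left side the square of \<open>6 * x\<close>.\<close>

lemma sum_inverse_3:
  assumes "p > 3"
  shows "(\<Sum>x\<in>{0..<p}. of_bool [3 * x\<^sup>2 = 1] (mod p)) = 1 + \<chi> 12"
proof -
  have "\<not> p dvd 2" "\<not> p dvd 3"
    using assms by (auto dest: zdvd_imp_le)
  then have ndvd: "\<not> p dvd 6" "\<not> p dvd 12"
    using prime prime_dvd_mult_iff[of p 2 3] prime_dvd_mult_iff[of p 2 6] by simp_all
  have per: "of_bool [(z mod p)\<^sup>2 = 12] (mod p) = (of_bool [z\<^sup>2 = 12] (mod p) :: int)" for z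
    by (simp add: cong_def mod_simps)
  have "[3 * x\<^sup>2 = 1] (mod p) \<longleftrightarrow> [(6 * x + 0)\<^sup>2 = 12] (mod p)" for x
    using cong_mult_cancel[OF ndvd(2), of "3 * x\<^sup>2" 1] by (simp add: power_mult_distrib)
  then show ?thesis
    using sum_affine[where g = "\<lambda>z. of_bool [z\<^sup>2 = 12] (mod p)", OF per ndvd(1), of 0]
    by (simp only: sum_square_roots)
qed

lemma sum_cubic_eq:
  assumes "p > 3"
  shows "(\<Sum>x\<in>{0..<p}. \<Sum>y\<in>{0..<p}. of_bool [x ^ 3 - x = y ^ 3 - y] (mod p)) = 2 * p - 1 - \<chi> (- 3) - \<chi> 12"
proof -
  \<comment> \<open>Inclusion-exclusion for indicators of the diagonal and the conic; the factor 1
    gives the first term the shape of \<open>sum_diagonal\<close>.\<close>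
  have "of_bool [x ^ 3 - x = y ^ 3 - y] (mod p) = of_bool [x = y] (mod p) * 1
      + of_bool [x\<^sup>2 + x * y + y\<^sup>2 = 1] (mod p)
      - of_bool [x = y] (mod p) * (of_bool [3 * x\<^sup>2 = 1] (mod p) :: int)" for x y
  proof -
    have "x ^ 3 - x - (y ^ 3 - y) = (x - y) * (x\<^sup>2 + x * y + y\<^sup>2 - 1)"
      by (simp add: algebra_simps power2_eq_square power3_eq_cube)
    then have "[x ^ 3 - x = y ^ 3 - y] (mod p) \<longleftrightarrow> [x = y] (mod p) \<or> [x\<^sup>2 + x * y + y\<^sup>2 = 1] (mod p)"
      using prime by (simp only: cong_iff_dvd_diff prime_dvd_mult_iff)
    moreover have "[x\<^sup>2 + x * y + y\<^sup>2 = 1] (mod p) \<longleftrightarrow> [3 * x\<^sup>2 = 1] (mod p)" if "[x = y] (mod p)"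
    proof -
      have "[x\<^sup>2 + x * y + y\<^sup>2 = x\<^sup>2 + x * x + x\<^sup>2] (mod p)"
        using that by (intro cong_add cong_mult cong_pow cong_refl) (auto simp: cong_sym)
      moreover have "x\<^sup>2 + x * x + x\<^sup>2 = 3 * x\<^sup>2"
        by (simp add: power2_eq_square)
      ultimately show ?thesis
        by (simp add: cong_def)
    qed
    ultimately show ?thesis by auto
  qed
  then have "(\<Sum>x\<in>{0..<p}. \<Sum>y\<in>{0..<p}. of_bool [x ^ 3 - x = y ^ 3 - y] (mod p)) =
      (\<Sum>x\<in>{0..<p}. 1 :: int) + (\<Sum>x\<in>{0..<p}. \<Sum>y\<in>{0..<p}. of_bool [x\<^sup>2 + x * y + y\<^sup>2 = 1] (mod p))
      - (\<Sum>x\<in>{0..<p}. of_bool [3 * x\<^sup>2 = 1] (mod p))"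
    by (simp only: sum.distrib sum_subtractf sum_diagonal)
  also have "(\<Sum>x\<in>{0..<p}. \<Sum>y\<in>{0..<p}. of_bool [x\<^sup>2 + x * y + y\<^sup>2 = 1] (mod p)) = p - \<chi> (- 3)"
    using sum_conic[OF assms] by (subst sum.swap)
  finally show ?thesis
    using assms by (simp add: sum_inverse_3)
qed

end

theorem lemma2p7:
  fixes p :: int
  assumes "prime p" and "p > 3"
  shows "second_moment E_family p =
    p\<^sup>2 - p - p * Legendre (-3) p - p * Legendre 12 p
      - (\<Sum>x\<in>{0..<p}. \<Sum>y\<in>{0..<p}. Legendre (x ^ 3 - x) p * Legendre (y ^ 3 - y) p)"
proof -
  interpret odd_prime p
    using assms by unfold_locales auto
  define F where "F t = (\<Sum>x\<in>{0..<p}. \<chi> (x ^ 3 - x + t))\<^sup>2" for t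
  have F_eq: "F t = (\<Sum>x\<in>{0..<p}. \<Sum>y\<in>{0..<p}. \<chi> (x ^ 3 - x + t) * \<chi> (y ^ 3 - y + t))" for t
    by (simp only: F_def power2_eq_square sum_product)
  \<comment> \<open>Completing the sum to all \<open>t\<close> costs exactly \<open>F 0\<close>,
    which is the double sum of the claim.\<close>
  have "second_moment E_family p = (\<Sum>t\<in>{0..<p}. F t - of_bool (p dvd t) * F t)"
    unfolding second_moment_def
    by (intro sum.cong) (auto simp: frob_trace_E_family_power2 F_def)
  also have "\<dots> = (\<Sum>t\<in>{0..<p}. F t) - F 0"
    by (simp only: sum_subtractf sum_of_bool_dvd)
  also have "(\<Sum>t\<in>{0..<p}. F t) =
      (\<Sum>x\<in>{0..<p}. \<Sum>y\<in>{0..<p}. \<Sum>t\<in>{0..<p}. \<chi> (x ^ 3 - x + t) * \<chi> (y ^ 3 - y + t))"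
    unfolding F_eq by (subst sum.swap) (rule sum.cong[OF refl], rule sum.swap)
  \<comment> \<open>Each pair \<open>(x, y)\<close> contributes -1, and \<open>p\<close> more if it
    solves the cubic congruence; there are \<open>p * p\<close> pairs.\<close>
  also have "\<dots> = p * (2 * p - 1 - \<chi> (- 3) - \<chi> 12) - p * p"
    using assms by (simp add: sum_Legendre_shift_mult_shift sum_subtractf sum_cubic_eq flip: sum_distrib_left)
  finally show ?thesis
    by (simp add: F_eq algebra_simps power2_eq_square)
qed

end
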